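(* For every $0 \leq \delta < \varepsilon \leq 1$ and every $p \in [1, \infty)$, there is a polynomial-time reduction from any $(\delta, \varepsilon)$-Gap-$2$-SAT instance with $n$ variables to an instance of $\gamma$-$\mathrm{CVP}_p$ of rank $n$, where \[ \gamma := \left(\frac{\delta + (1 - \delta) \cdot 3^p}{\varepsilon + (1 - \varepsilon) \cdot 3^p} \right)^{1/p} > 1 . \] In particular, when $\varepsilon = 1$, the corresponding approximation factor is $(\delta + (1-\delta) \cdot 3^p)^{1/p}$.
   Context: A $2$-SAT formula is a conjunction of clauses, each a disjunction of (at most) $2$ literals; $\mathrm{val}(\Phi)$ is the maximum over assignments of the fraction of clauses satisfied. $(\delta,\varepsilon)$-Gap-$2$-SAT is the promise problem of distinguishing YES instances with $\mathrm{val}(\Phi)\ge\varepsilon$ from NO instances with $\mathrm{val}(\Phi)<\delta$. A lattice of rank $n$ is $\mathcal{L}(B)=\{B\vec z:\vec z\in\mathbb{Z}^n\}$ for $B\in\mathbb{R}^{d\times n}$ with linearly independent columns. For $\gamma\ge1$, $\gamma$-$\mathrm{CVP}_p$ is the promise problem: given $B$, $\vec t\in\mathbb{R}^d$ and $r>0$, distinguish YES instances with $\mathrm{dist}_p(\mathcal{L}(B),\vec t)\le r$ from NO instances with $\mathrm{dist}_p(\mathcal{L}(B),\vec t)>\gamma r$, where $\mathrm{dist}_p(\mathcal{L},\vec t)=\min_{\vec x\in\mathcal{L}}\|\vec x-\vec t\|_p$ and $\|\vec x\|_p=(\sum_i|x_i|^p)^{1/p}$. *)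

theory Defs
  imports
    Complex_Main
    "HOL-Computational_Algebra.Polynomial"
    "Jordan_Normal_Form.Matrix"
begin

section \<open>Promise problems\<close>

text \<open>A pair of the set of YES instances and the set of NO instances.\<close>

type_synonym 'a promise_problem = "'a set \<times> 'a set"

section \<open>Gap 2-SAT\<close>

datatype literal = Pos nat | Neg nat

primrec lit_var :: "literal \<Rightarrow> nat" where
  "lit_var (Pos v) = v"
| "lit_var (Neg v) = v"

primrec lit_true :: "(nat \<Rightarrow> bool) \<Rightarrow> literal \<Rightarrow> bool" where
  "lit_true a (Pos v) \<longleftrightarrow> a v"
| "lit_true a (Neg v) \<longleftrightarrow> \<not> a v"

type_synonym clause = "literal list"

text \<open>The number of variables (which are \<open>0, \<dots>, n - 1\<close>) and the clauses.  Clauses form a list,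
  so a repeated clause counts with its multiplicity in the fraction of satisfied clauses.\<close>

type_synonym cnf = "nat \<times> clause list"

abbreviation num_vars :: "cnf \<Rightarrow> nat" where "num_vars \<equiv> fst"
abbreviation clauses :: "cnf \<Rightarrow> clause list" where "clauses \<equiv> snd"

text \<open>There is at least one clause, since the fraction of satisfied clauses is meaningless otherwise.\<close>

definition two_sat_formula :: "cnf \<Rightarrow> bool" where
  "two_sat_formula \<Phi> \<longleftrightarrow> clauses \<Phi> \<noteq> [] \<and>
     (\<forall>C \<in> set (clauses \<Phi>). length C \<le> 2 \<and> (\<forall>l \<in> set C. lit_var l < num_vars \<Phi>))"

definition clause_true :: "(nat \<Rightarrow> bool) \<Rightarrow> clause \<Rightarrow> bool" where
  "clause_true a C \<longleftrightarrow> (\<exists>l \<in> set C. lit_true a l)"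

definition sat_fraction :: "(nat \<Rightarrow> bool) \<Rightarrow> cnf \<Rightarrow> real" where
  "sat_fraction a \<Phi> =
     real (length (filter (clause_true a) (clauses \<Phi>))) / real (length (clauses \<Phi>))"

text \<open>An assignment is a total function on the naturals of which only the values at the variables
  matter; only finitely many fractions occur, so this is a genuine maximum.\<close>

definition sat_val :: "cnf \<Rightarrow> real" where
  "sat_val \<Phi> = Max (range (\<lambda>a. sat_fraction a \<Phi>))"

definition gap_2sat :: "real \<Rightarrow> real \<Rightarrow> cnf promise_problem" where
  "gap_2sat \<delta> \<epsilon> =
     ({\<Phi>. two_sat_formula \<Phi> \<and> sat_val \<Phi> \<ge> \<epsilon>}, {\<Phi>. two_sat_formula \<Phi> \<and> sat_val \<Phi> < \<delta>})"

section \<open>The closest vector problem\<close>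

definition lp_norm :: "real \<Rightarrow> real vec \<Rightarrow> real" where
  "lp_norm p x = (\<Sum>i<dim_vec x. \<bar>x $ i\<bar> powr p) powr (1 / p)"

definition lattice_of_basis :: "real mat \<Rightarrow> real vec set" where
  "lattice_of_basis B = {B *\<^sub>v map_vec real_of_int z | z. z \<in> carrier_vec (dim_col B)}"

definition lin_indep_cols :: "real mat \<Rightarrow> bool" where
  "lin_indep_cols B \<longleftrightarrow>
     (\<forall>x \<in> carrier_vec (dim_col B). B *\<^sub>v x = 0\<^sub>v (dim_row B) \<longrightarrow> x = 0\<^sub>v (dim_col B))"

text \<open>The infimum is a minimum when \<open>L\<close> is a lattice, because lattices are discrete.\<close>

definition lp_dist :: "real \<Rightarrow> real vec set \<Rightarrow> real vec \<Rightarrow> real" where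
  "lp_dist p L t = (INF x\<in>L. lp_norm p (x - t))"

type_synonym cvp_inst = "real mat \<times> real vec \<times> real"

fun cvp_instance :: "nat \<Rightarrow> cvp_inst \<Rightarrow> bool" where
  "cvp_instance n (B, t, r) \<longleftrightarrow>
     dim_col B = n \<and> lin_indep_cols B \<and> dim_vec t = dim_row B \<and> r > 0"

definition gap_cvp :: "real \<Rightarrow> real \<Rightarrow> cvp_inst promise_problem" where
  "gap_cvp \<gamma> p =
     ({(B, t, r). (\<exists>n. cvp_instance n (B, t, r)) \<and> lp_dist p (lattice_of_basis B) t \<le> r},
      {(B, t, r). (\<exists>n. cvp_instance n (B, t, r)) \<and> lp_dist p (lattice_of_basis B) t > \<gamma> * r})"

section \<open>Polynomial time\<close>

text \<open>
  Polynomial time is that of a random access machine, programmed in a structured language.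
  The store consists of arrays of natural numbers, indexed by natural numbers; a program mentions
  only finitely many arrays.  The arithmetic operations are addition and truncated subtraction, so
  a number occurring in the first \<open>k\<close> steps has \<open>O(k)\<close> more bits than the input numbers, and
  unit-cost time is polynomially equivalent to Turing machine time (Cook and Reckhow, 1973).
  The output is written number by number with \<open>Emit\<close>; hence it is never longer than the running time.
\<close>

datatype aexp =
    Num nat
  | Read nat aexp
  | Add aexp aexp
  | Sub aexp aexp

datatype com =
    Skip
  | Write nat aexp aexp
  | Emit aexp
  | Seq com com
  | IfLess aexp aexp com com
  | WhileLess aexp aexp com

type_synonym store = "nat \<Rightarrow> nat \<Rightarrow> nat"

primrec aval :: "aexp \<Rightarrow> store \<Rightarrow> nat" where
  "aval (Num k) s = k"
| "aval (Read x i) s = s x (aval i s)"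
| "aval (Add a b) s = aval a s + aval b s"
| "aval (Sub a b) s = aval a s - aval b s"

text \<open>\<open>exec c s k s' out\<close>: started in store \<open>s\<close>, the program \<open>c\<close> halts after \<open>k\<close> steps in store \<open>s'\<close>
  and has emitted the list \<open>out\<close>.\<close>

inductive exec :: "com \<Rightarrow> store \<Rightarrow> nat \<Rightarrow> store \<Rightarrow> nat list \<Rightarrow> bool" where
  Skip: "exec Skip s 1 s []"
| Write: "exec (Write x i e) s 1 (s(x := (s x)(aval i s := aval e s))) []"
| Emit: "exec (Emit e) s 1 s [aval e s]"
| Seq: "exec c1 s k1 s1 out1 \<Longrightarrow> exec c2 s1 k2 s2 out2 \<Longrightarrow>
    exec (Seq c1 c2) s (k1 + k2) s2 (out1 @ out2)"
| IfTrue: "aval a s < aval b s \<Longrightarrow> exec c1 s k s' out \<Longrightarrow>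
    exec (IfLess a b c1 c2) s (k + 1) s' out"
| IfFalse: "\<not> aval a s < aval b s \<Longrightarrow> exec c2 s k s' out \<Longrightarrow>
    exec (IfLess a b c1 c2) s (k + 1) s' out"
| WhileFalse: "\<not> aval a s < aval b s \<Longrightarrow> exec (WhileLess a b c) s 1 s []"
| WhileTrue: "aval a s < aval b s \<Longrightarrow> exec c s k1 s1 out1 \<Longrightarrow>
    exec (WhileLess a b c) s1 k2 s2 out2 \<Longrightarrow>
    exec (WhileLess a b c) s (k1 + k2 + 1) s2 (out1 @ out2)"

inductive_cases exec_SkipE: "exec Skip s k s' out"
inductive_cases exec_WriteE: "exec (Write x i e) s k s' out"
inductive_cases exec_EmitE: "exec (Emit e) s k s' out"
inductive_cases exec_SeqE: "exec (Seq c1 c2) s k s' out"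
inductive_cases exec_IfE: "exec (IfLess a b c1 c2) s k s' out"
inductive_cases exec_WhileE: "exec (WhileLess a b c) s k s' out"

lemma exec_deterministic:
  "exec c s k s' out \<Longrightarrow> exec c s l s'' out' \<Longrightarrow> l = k \<and> s'' = s' \<and> out' = out"
proof (induction arbitrary: l s'' out' rule: exec.induct)
  case (Skip s) then show ?case by (auto elim: exec_SkipE)
next
  case (Write x i e s) then show ?case by (auto elim: exec_WriteE)
next
  case (Emit e s) then show ?case by (auto elim: exec_EmitE)
next
  case (Seq c1 s k1 s1 out1 c2 k2 s2 out2)
  from Seq.prems show ?case by (rule exec_SeqE) (metis Seq.IH)
next
  case (IfTrue a s b c1 k s' out c2)
  from IfTrue.prems show ?case by (rule exec_IfE) (simp_all only: Suc_eq_plus1, (metis IfTrue.IH IfTrue.hyps(1))+)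
next
  case (IfFalse a s b c2 k s' out c1)
  from IfFalse.prems show ?case by (rule exec_IfE) (simp_all only: Suc_eq_plus1, (metis IfFalse.IH IfFalse.hyps(1))+)
next
  case (WhileFalse a s b c)
  from WhileFalse.prems show ?case by (rule exec_WhileE) (use WhileFalse.hyps in simp_all)
next
  case (WhileTrue a s b c k1 s1 out1 k2 s2 out2)
  from WhileTrue.prems show ?case by (rule exec_WhileE) (simp_all only: Suc_eq_plus1, (metis WhileTrue.IH WhileTrue.hyps(1))+)
qed

text \<open>The input occupies the beginning of array \<open>0\<close>; all other cells are \<open>0\<close>.\<close>

definition input_store :: "nat list \<Rightarrow> store" where
  "input_store ws = (\<lambda>x i. if x = 0 \<and> i < length ws then ws ! i else 0)"

text \<open>\<open>f\<close> is computed in polynomial time on \<open>X\<close>: \<open>code\<close> encodes the inputs, \<open>sz\<close> is the input size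
  and \<open>repr out y\<close> says that \<open>out\<close> is a description of \<open>y\<close>.\<close>

definition poly_time_computable ::
  "'a set \<Rightarrow> ('a \<Rightarrow> nat list) \<Rightarrow> ('a \<Rightarrow> nat) \<Rightarrow> (nat list \<Rightarrow> 'b \<Rightarrow> bool) \<Rightarrow> ('a \<Rightarrow> 'b) \<Rightarrow> bool" where
  "poly_time_computable X code sz repr f \<longleftrightarrow>
     (\<exists>c. \<exists>q :: nat poly. \<forall>x \<in> X. \<exists>k s out.
        exec c (input_store (code x)) k s out \<and> k \<le> poly q (sz x) \<and> repr out (f x))"

definition maps_promise :: "('a \<Rightarrow> 'b) \<Rightarrow> 'a promise_problem \<Rightarrow> 'b promise_problem \<Rightarrow> bool" where
  "maps_promise f P Q \<longleftrightarrow> (\<forall>x \<in> fst P. f x \<in> fst Q) \<and> (\<forall>x \<in> snd P. f x \<in> snd Q)"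

section \<open>Encodings\<close>

text \<open>A formula is given by \<open>n\<close>, \<open>m\<close> and \<open>m\<close> blocks of four numbers, one block per clause; absent
  literals are padded with zeros.  As all numbers in the code are at most \<open>max n (max m 2)\<close>, the
  size \<open>n + m\<close> is polynomially related to the bit length (the number of variables in unary).\<close>

primrec lit_code :: "literal \<Rightarrow> nat list" where
  "lit_code (Pos v) = [1, v]"
| "lit_code (Neg v) = [2, v]"

definition clause_code :: "clause \<Rightarrow> nat list" where
  "clause_code C = concat (map lit_code C) @ replicate (4 - 2 * length C) 0"

definition cnf_code :: "cnf \<Rightarrow> nat list" where
  "cnf_code \<Phi> = num_vars \<Phi> # length (clauses \<Phi>) # concat (map clause_code (clauses \<Phi>))"

definition cnf_size :: "cnf \<Rightarrow> nat" where
  "cnf_size \<Phi> = num_vars \<Phi> + length (clauses \<Phi>)"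

text \<open>
  An instance of the closest vector problem consists of real numbers, which in general (for example
  the \<open>p\<close>-norm of an integer vector, or a number depending on real parameters such as \<open>\<delta>\<close> and \<open>\<epsilon>\<close>)
  have no finite binary representation.  They are described exactly, by closed expressions built
  with the field operations, \<open>p\<close>-th powers of natural numbers and \<open>p\<close>-th roots from natural numbers
  in binary and a fixed list \<open>\<theta>\<close> of real parameters.  Expressions are trees without sharing, and
  \<open>p\<close>-th powers cannot be iterated; so no number of superpolynomial bit length can be described by
  iterated squaring, as would be the case with unit-cost real arithmetic.
\<close>

datatype rexp =
    RNat nat
  | RParam nat
  | RPow nat
  | RAdd rexp rexp
  | RSub rexp rexp
  | RMul rexp rexp
  | RDiv rexp rexp
  | RRoot rexp

primrec rval :: "real list \<Rightarrow> real \<Rightarrow> rexp \<Rightarrow> real" where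
  "rval \<theta> p (RNat k) = real k"
| "rval \<theta> p (RParam i) = (if i < length \<theta> then \<theta> ! i else 0)"
| "rval \<theta> p (RPow k) = real k powr p"
| "rval \<theta> p (RAdd a b) = rval \<theta> p a + rval \<theta> p b"
| "rval \<theta> p (RSub a b) = rval \<theta> p a - rval \<theta> p b"
| "rval \<theta> p (RMul a b) = rval \<theta> p a * rval \<theta> p b"
| "rval \<theta> p (RDiv a b) = rval \<theta> p a / rval \<theta> p b"
| "rval \<theta> p (RRoot a) = rval \<theta> p a powr (1 / p)"

primrec rexp_code :: "rexp \<Rightarrow> nat list" where
  "rexp_code (RNat k) = [0, k]"
| "rexp_code (RParam i) = [1, i]"
| "rexp_code (RPow k) = [2, k]"
| "rexp_code (RAdd a b) = 3 # rexp_code a @ rexp_code b"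
| "rexp_code (RSub a b) = 4 # rexp_code a @ rexp_code b"
| "rexp_code (RMul a b) = 5 # rexp_code a @ rexp_code b"
| "rexp_code (RDiv a b) = 6 # rexp_code a @ rexp_code b"
| "rexp_code (RRoot a) = 7 # rexp_code a"

text \<open>The code of \<open>(B, t, r)\<close>: the dimensions of \<open>B\<close>, its entries row by row, the entries of \<open>t\<close>,
  and \<open>r\<close>.\<close>

fun cvp_repr :: "real list \<Rightarrow> real \<Rightarrow> nat list \<Rightarrow> cvp_inst \<Rightarrow> bool" where
  "cvp_repr \<theta> p out (B, t, r) \<longleftrightarrow>
     (\<exists>d n es ts e. length es = d * n \<and> length ts = d \<and>
        out = d # n # concat (map rexp_code (es @ ts @ [e])) \<and>
        B = mat d n (\<lambda>(i, j). rval \<theta> p (es ! (i * n + j))) \<and>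
        t = vec d (\<lambda>i. rval \<theta> p (ts ! i)) \<and>
        r = rval \<theta> p e)"

lemma rexp_code_prefix_free:
  "rexp_code a @ u = rexp_code b @ v \<Longrightarrow> a = b \<and> u = v"
proof (induction a arbitrary: b u v)
  case (RNat k) then show ?case by (cases b) auto
next
  case (RParam i) then show ?case by (cases b) auto
next
  case (RPow k) then show ?case by (cases b) auto
next
  case (RAdd a1 a2)
  from RAdd.prems show ?case
    by (cases b) (simp_all, metis RAdd.IH)
next
  case (RSub a1 a2)
  from RSub.prems show ?case
    by (cases b) (simp_all, metis RSub.IH)
next
  case (RMul a1 a2)
  from RMul.prems show ?case
    by (cases b) (simp_all, metis RMul.IH)
next
  case (RDiv a1 a2)
  from RDiv.prems show ?case
    by (cases b) (simp_all, metis RDiv.IH)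
next
  case (RRoot a) from RRoot.prems show ?case by (cases b) (simp_all, metis RRoot.IH)
qed

lemma rexp_codes_inject:
  "length xs = length ys \<Longrightarrow>
     concat (map rexp_code xs) = concat (map rexp_code ys) \<longleftrightarrow> xs = ys"
  by (induction xs ys rule: list_induct2) (auto dest: rexp_code_prefix_free rexp_code_prefix_free[of _ "[]" _ "[]", simplified])

lemma cvp_repr_unique:
  assumes "cvp_repr \<theta> p out I" "cvp_repr \<theta> p out J"
  shows "I = J"
proof -
  obtain B t r B' t' r' where IJ: "I = (B, t, r)" "J = (B', t', r')"
    by (cases I, cases J) auto
  from assms(1) obtain d n es ts e where 1: "length es = d * n" "length ts = d"
    "out = d # n # concat (map rexp_code (es @ ts @ [e]))"
    "B = mat d n (\<lambda>(i, j). rval \<theta> p (es ! (i * n + j)))"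
    "t = vec d (\<lambda>i. rval \<theta> p (ts ! i))" "r = rval \<theta> p e"
    unfolding IJ cvp_repr.simps by blast
  from assms(2) obtain d' n' es' ts' e' where 2: "length es' = d' * n'" "length ts' = d'"
    "out = d' # n' # concat (map rexp_code (es' @ ts' @ [e']))"
    "B' = mat d' n' (\<lambda>(i, j). rval \<theta> p (es' ! (i * n' + j)))"
    "t' = vec d' (\<lambda>i. rval \<theta> p (ts' ! i))" "r' = rval \<theta> p e'"
    unfolding IJ cvp_repr.simps by blast
  have dn: "d' = d" "n' = n" using 1(3) 2(3) by auto
  have "concat (map rexp_code (es @ ts @ [e])) = concat (map rexp_code (es' @ ts' @ [e']))"
    using 1(3) 2(3) by (simp only: list.inject)
  then have "es @ ts @ [e] = es' @ ts' @ [e']"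
    using 1(1,2) 2(1,2) dn by (subst (asm) rexp_codes_inject) auto
  then have "es = es'" "ts = ts'" "e = e'"
    using 1(1,2) 2(1,2) dn by auto
  then show ?thesis unfolding IJ 1 2 dn by (simp add: 1 2 dn)
qed

end

(* A clause with literals l, l' becomes the row 2 (y_l + y_l') - 3, where y_v = z_v for a variable
   and y_v = 1 - z_v for its negation.  The row is odd, so its absolute value is at least 1, and it is
   at least 3 unless the rounding z_v >= 1 satisfies the clause; 0/1 vectors attain these values.
   These rows need not have full column rank, so a row alpha z_v is added for every variable.
   The added weight b = alpha^p must not eat up the gap: in a NO instance at most k < delta m clauses
   are satisfiable, and b has to be small compared to delta m - k, which can be arbitrarily close
   to 0.  A computable such b is obtained from the sum of 1 / ((delta m - k)^2 + c) over all k < m,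
   where c = 0 if delta is irrational, and 1/c is a denominator of delta otherwise. *)

theory Submission
  imports Defs
begin

section \<open>Step counts and output of machine programs\<close>

section \<open>Running programs\<close>

text \<open>The final store is hidden and only a frame condition is kept: arrays outside
  \<open>W\<close> are unchanged. This suffices because the programs below write nothing but loop
  counters, and each loop resets its own counter.\<close>

definition runs :: "nat set \<Rightarrow> store \<Rightarrow> com \<Rightarrow> nat \<Rightarrow> nat list \<Rightarrow> bool" where
  "runs W s c K out \<longleftrightarrow> (\<exists>k s'. exec c s k s' out \<and> k \<le> K \<and> (\<forall>x. x \<notin> W \<longrightarrow> s' x = s x))"

lemma runsI:
  "exec c s k s' out \<Longrightarrow> k \<le> K \<Longrightarrow> (\<And>x. x \<notin> W \<Longrightarrow> s' x = s x) \<Longrightarrow> runs W s c K out"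
  unfolding runs_def by blast

lemma runsE:
  assumes "runs W s c K out"
  obtains k s' where "exec c s k s' out" "k \<le> K" "\<And>x. x \<notin> W \<Longrightarrow> s' x = s x"
  using assms unfolding runs_def by blast

lemma runs_mono:
  "runs W s c K out \<Longrightarrow> W \<subseteq> W' \<Longrightarrow> K \<le> K' \<Longrightarrow> runs W' s c K' out"
  by (erule runsE, erule runsI) auto

lemma runs_Emit: "runs W s (Emit e) 1 [aval e s]"
  by (rule runsI[OF exec.Emit]) auto

text \<open>About the intermediate store only the frame condition is known, so the second program
  has to behave well from every store that agrees with \<open>s\<close> outside
  \<open>W\<close>.\<close>

lemma runs_Seq:
  assumes "runs W s c1 K1 out1"
    and "\<And>s'. (\<forall>x. x \<notin> W \<longrightarrow> s' x = s x) \<Longrightarrow> runs W s' c2 K2 out2"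
  shows "runs W s (Seq c1 c2) (K1 + K2) (out1 @ out2)"
proof -
  obtain k1 s1 where 1: "exec c1 s k1 s1 out1" "k1 \<le> K1" "\<forall>x. x \<notin> W \<longrightarrow> s1 x = s x"
    using assms(1) unfolding runs_def by blast
  obtain k2 s2 where 2: "exec c2 s1 k2 s2 out2" "k2 \<le> K2" "\<forall>x. x \<notin> W \<longrightarrow> s2 x = s1 x"
    using assms(2)[OF 1(3)] unfolding runs_def by blast
  have "exec (Seq c1 c2) s (k1 + k2) s2 (out1 @ out2)"
    using exec.Seq 1(1) 2(1) by blast
  moreover have "k1 + k2 \<le> K1 + K2" using 1(2) 2(2) by simp
  ultimately show ?thesis by (rule runsI) (simp add: 1(3) 2(3))
qed

lemma runs_IfLess:
  assumes "aval a s < aval b s \<Longrightarrow> runs W s c1 K out"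
    and "\<not> aval a s < aval b s \<Longrightarrow> runs W s c2 K out"
  shows "runs W s (IfLess a b c1 c2) (K + 1) out"
proof (cases "aval a s < aval b s")
  case True
  from assms(1)[OF this] show ?thesis
    by (elim runsE) (rule runsI[OF exec.IfTrue[OF True]], assumption, auto)
next
  case False
  from assms(2)[OF this] show ?thesis
    by (elim runsE) (rule runsI[OF exec.IfFalse[OF False]], assumption, auto)
qed

primrec emit_all :: "aexp list \<Rightarrow> com" where
  "emit_all [] = Skip"
| "emit_all (e # es) = Seq (Emit e) (emit_all es)"

lemma exec_emit_all: "exec (emit_all es) s (length es + 1) s (map (\<lambda>e. aval e s) es)"
proof (induction es)
  case Nil
  then show ?case using exec.Skip by simp
next
  case (Cons e es)
  show ?case using exec.Seq[OF exec.Emit Cons.IH, of e] by simp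
qed

lemma runs_emit_all:
  "map (\<lambda>e. aval e s) es = out \<Longrightarrow> length es + 1 \<le> K \<Longrightarrow> runs W s (emit_all es) K out"
  using runsI[OF exec_emit_all[of es s]] by auto

abbreviation counter :: "nat \<Rightarrow> aexp" where
  "counter x \<equiv> Read x (Num 0)"

definition for_less :: "nat \<Rightarrow> aexp \<Rightarrow> com \<Rightarrow> com" where
  "for_less x e c = Seq (Write x (Num 0) (Num 0))
     (WhileLess (counter x) e (Seq c (Write x (Num 0) (Add (counter x) (Num 1)))))"

text \<open>Each round costs \<open>K + 2\<close>: the loop test, the body, and the increment. The
  extra \<open>2\<close> pays for the initialisation and the final failing test. Requiring
  \<open>x\<close> outside \<open>W\<close> keeps the body from disturbing the counter.\<close>

lemma runs_for_less:
  assumes x: "x \<notin> W"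
    and bound: "\<And>s'. (\<forall>y. y \<notin> insert x W \<longrightarrow> s' y = s y) \<Longrightarrow> aval e s' = N"
    and body: "\<And>s' i. (\<forall>y. y \<notin> insert x W \<longrightarrow> s' y = s y) \<Longrightarrow> s' x 0 = i \<Longrightarrow> i < N \<Longrightarrow>
      runs W s' c K (g i)"
  shows "runs (insert x W) s (for_less x e c) (N * (K + 2) + 2) (concat (map g [0..<N]))"
proof -
  let ?step = "Seq c (Write x (Num 0) (Add (counter x) (Num 1)))"
  \<comment> \<open>The claim is generalised to a loop entered with counter value \<open>i\<close>,
    so that induction on the number \<open>N - i\<close> of remaining rounds applies.\<close>
  have loop: "runs (insert x W) s' (WhileLess (counter x) e ?step) ((N - i) * (K + 2) + 1)
      (concat (map g [i..<N]))"
    if "\<forall>y. y \<notin> insert x W \<longrightarrow> s' y = s y" "s' x 0 = i" "i \<le> N" for s' i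
    using that
  proof (induction "N - i" arbitrary: i s')
    case 0
    then have "exec (WhileLess (counter x) e ?step) s' 1 s' (concat (map g [i..<N]))"
      using bound[OF 0(2)] exec.WhileFalse[of "counter x" s' e ?step] by simp
    then show ?case by (rule runsI) (use 0 in simp_all)
  next
    case (Suc d)
    then have i: "i < N" by simp
    obtain k1 s1 where 1: "exec c s' k1 s1 (g i)" "k1 \<le> K" "\<forall>y. y \<notin> W \<longrightarrow> s1 y = s' y"
      using body[OF Suc.prems(1,2) i] unfolding runs_def by blast
    define s2 where "s2 = s1(x := (s1 x)(0 := Suc i))"
    have s1x: "s1 x 0 = i" using 1(3) x Suc.prems by simp
    have step: "exec ?step s' (k1 + 1) s2 (g i @ [])"
      using exec.Seq[OF 1(1) exec.Write, of x "Num 0" "Add (counter x) (Num 1)"] s1x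
      unfolding s2_def by simp
    have agree: "\<forall>y. y \<notin> insert x W \<longrightarrow> s2 y = s y"
      using 1(3) Suc.prems(1) by (simp add: s2_def)
    have "runs (insert x W) s2 (WhileLess (counter x) e ?step) ((N - Suc i) * (K + 2) + 1)
      (concat (map g [Suc i..<N]))"
      using Suc.hyps(2) i agree by (intro Suc.hyps(1)) (auto simp: s2_def)
    then obtain k2 s3 where 2: "exec (WhileLess (counter x) e ?step) s2 k2 s3
        (concat (map g [Suc i..<N]))"
      "k2 \<le> (N - Suc i) * (K + 2) + 1" "\<forall>y. y \<notin> insert x W \<longrightarrow> s3 y = s2 y"
      unfolding runs_def by blast
    have "aval (counter x) s' < aval e s'"
      using bound[OF Suc.prems(1)] Suc.prems(2) i by simp
    from exec.WhileTrue[OF this step 2(1)]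
    have "exec (WhileLess (counter x) e ?step) s' (k1 + 1 + k2 + 1) s3 (concat (map g [i..<N]))"
      using i by (simp add: upt_conv_Cons)
    moreover have "k1 + 1 + k2 + 1 \<le> (N - i) * (K + 2) + 1"
    proof -
      have "N - i = Suc (N - Suc i)" using i by simp
      then show ?thesis using 1(2) 2(2) by simp
    qed
    moreover have "s3 y = s' y" if "y \<notin> insert x W" for y
      using that 2(3) agree Suc.prems(1) by simp
    ultimately show ?case by (rule runsI)
  qed
  define s0 where "s0 = s(x := (s x)(0 := 0))"
  have "runs (insert x W) s0 (WhileLess (counter x) e ?step) (N * (K + 2) + 1)
      (concat (map g [0..<N]))"
    using loop[of s0 0] by (simp add: s0_def)
  then obtain k s' where 1: "exec (WhileLess (counter x) e ?step) s0 k s' (concat (map g [0..<N]))"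
    "k \<le> N * (K + 2) + 1" "\<forall>y. y \<notin> insert x W \<longrightarrow> s' y = s0 y"
    unfolding runs_def by blast
  have "exec (Write x (Num 0) (Num 0)) s 1 s0 []"
    using exec.Write[of x "Num 0" "Num 0" s] by (simp add: s0_def)
  from exec.Seq[OF this 1(1)]
  have "exec (for_less x e c) s (1 + k) s' (concat (map g [0..<N]))"
    unfolding for_less_def by simp
  moreover have "1 + k \<le> N * (K + 2) + 2" using 1(2) by simp
  ultimately show ?thesis by (rule runsI) (simp add: 1(3) s0_def)
qed


section \<open>Odd integers measuring how a clause is satisfied\<close>

section \<open>Clauses as lattice coordinates\<close>

primrec lit_val :: "(nat \<Rightarrow> int) \<Rightarrow> literal \<Rightarrow> int" where
  "lit_val z (Pos v) = z v"
| "lit_val z (Neg v) = 1 - z v"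

primrec is_neg :: "literal \<Rightarrow> bool" where
  "is_neg (Pos v) \<longleftrightarrow> False"
| "is_neg (Neg v) \<longleftrightarrow> True"

abbreviation num_neg :: "clause \<Rightarrow> nat" where
  "num_neg C \<equiv> length (filter is_neg C)"

definition clause_coord :: "(nat \<Rightarrow> int) \<Rightarrow> clause \<Rightarrow> int" where
  "clause_coord z C = 2 * (\<Sum>l\<leftarrow>C. lit_val z l) - 3"

text \<open>The left side is a matrix row applied to \<open>z\<close> minus the target entry. Each
  negative literal contributes a constant \<open>2\<close> from \<open>2 * (1 - z v)\<close>, which
  is moved into the target. Counting occurrences also covers clauses that repeat a variable.\<close>

lemma clause_coord_eq:
  assumes "\<forall>l \<in> set C. lit_var l < n"
  shows "(\<Sum>j<n. (2 * int (count_list C (Pos j)) - 2 * int (count_list C (Neg j))) * z j)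
    - (3 - 2 * int (num_neg C)) = clause_coord z C"
  using assms
proof (induction C)
  case Nil
  then show ?case by (simp add: clause_coord_def)
next
  case (Cons l C)
  show ?case
  proof (cases l)
    case (Pos v)
    have "(\<Sum>j<n. (2 * int (count_list (l # C) (Pos j)) - 2 * int (count_list (l # C) (Neg j))) * z j)
      = (\<Sum>j<n. (2 * int (count_list C (Pos j)) - 2 * int (count_list C (Neg j))) * z j
          + (if j = v then 2 * z j else 0))"
      by (intro sum.cong) (auto simp: Pos algebra_simps)
    then show ?thesis
      using Cons by (simp add: sum.distrib Pos clause_coord_def)
  next
    case (Neg v)
    have "(\<Sum>j<n. (2 * int (count_list (l # C) (Pos j)) - 2 * int (count_list (l # C) (Neg j))) * z j)
      = (\<Sum>j<n. (2 * int (count_list C (Pos j)) - 2 * int (count_list C (Neg j))) * z j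
          - (if j = v then 2 * z j else 0))"
      by (intro sum.cong) (auto simp: Neg algebra_simps)
    then show ?thesis
      using Cons by (simp add: sum_subtractf Neg clause_coord_def)
  qed
qed

text \<open>An even number minus \<open>3\<close> is odd, hence nonzero.\<close>

lemma abs_clause_coord_ge_1: "1 \<le> \<bar>clause_coord z C\<bar>"
  unfolding clause_coord_def by presburger

text \<open>Under the rounding \<open>1 \<le> z v\<close>, a false literal has value at most
  \<open>0\<close>, whatever the integers are. A falsified clause therefore has coordinate at most
  \<open>-3\<close>.\<close>

lemma abs_clause_coord_ge_3:
  assumes "\<not> clause_true (\<lambda>v. 1 \<le> z v) C"
  shows "3 \<le> \<bar>clause_coord z C\<bar>"
proof -
  have "lit_val z l \<le> 0" if "\<not> lit_true (\<lambda>v. 1 \<le> z v) l" for l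
    using that by (cases l) auto
  then have "(\<Sum>l\<leftarrow>C. lit_val z l) \<le> 0"
    using assms by (auto simp: clause_true_def intro!: sum_list_nonpos)
  then show ?thesis by (simp add: clause_coord_def)
qed

text \<open>Here clause width matters: with 0, 1 or 2 true literals the coordinate is
  \<open>-3\<close>, \<open>-1\<close> or \<open>1\<close>. Three true literals would give
  \<open>3\<close> again.\<close>

lemma abs_clause_coord_of_bool:
  assumes "length C \<le> 2"
  shows "\<bar>clause_coord (\<lambda>v. of_bool (a v)) C\<bar> = (if clause_true a C then 1 else 3)"
proof -
  have lit: "lit_val (\<lambda>v. of_bool (a v)) l = of_bool (lit_true a l)" for l
    by (cases l) auto
  consider "C = []" | l where "C = [l]" | l l' where "C = [l, l']"
    using assms by (cases C; cases "tl C"; cases "tl (tl C)") auto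
  then show ?thesis
    by cases (auto simp: clause_coord_def clause_true_def lit)
qed

lemma sum_nth_if:
  fixes a b :: real
  shows "(\<Sum>i<length xs. if P (xs ! i) then a else b) =
    real (length (filter P xs)) * a + (real (length xs) - real (length (filter P xs))) * b"
  by (induction xs) (simp_all add: sum.lessThan_Suc_shift algebra_simps del: sum.lessThan_Suc)

section \<open>The basis, the target and the radius, and the norms of difference vectors\<close>

section \<open>The reduction\<close>

definition matrix_entry :: "rexp \<Rightarrow> cnf \<Rightarrow> nat \<Rightarrow> nat \<Rightarrow> rexp" where
  "matrix_entry \<beta> \<Phi> i j = (let m = length (clauses \<Phi>) in
     if i < m then RSub (RNat (2 * count_list (clauses \<Phi> ! i) (Pos j)))
       (RNat (2 * count_list (clauses \<Phi> ! i) (Neg j)))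
     else if i - m = j then RRoot \<beta> else RNat 0)"

definition target_entry :: "cnf \<Rightarrow> nat \<Rightarrow> rexp" where
  "target_entry \<Phi> i = (if i < length (clauses \<Phi>)
     then RSub (RNat 3) (RNat (2 * num_neg (clauses \<Phi> ! i))) else RNat 0)"

text \<open>\<open>RParam 1\<close> stands for \<epsilon>. The radicand bounds the cost of a 0/1
  vector: at most \<beta> for each of the \<open>n\<close> weight rows, and \<open>1\<close> or
  \<open>3 powr p\<close> for each clause row when a fraction \<epsilon> of the clauses is
  satisfied.\<close>

definition radius :: "rexp \<Rightarrow> nat \<Rightarrow> nat \<Rightarrow> rexp" where
  "radius \<beta> n m = RRoot (RAdd (RMul (RNat n) \<beta>)
     (RMul (RNat m) (RAdd (RParam 1) (RMul (RSub (RNat 1) (RParam 1)) (RPow 3)))))"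

definition reduction :: "real list \<Rightarrow> real \<Rightarrow> (nat \<Rightarrow> nat \<Rightarrow> rexp) \<Rightarrow> cnf \<Rightarrow> cvp_inst" where
  "reduction \<theta> p \<beta> \<Phi> = (let n = num_vars \<Phi>; m = length (clauses \<Phi>) in
     (mat (m + n) n (\<lambda>(i, j). rval \<theta> p (matrix_entry (\<beta> n m) \<Phi> i j)),
      vec (m + n) (\<lambda>i. rval \<theta> p (target_entry \<Phi> i)),
      rval \<theta> p (radius (\<beta> n m) n m)))"

lemma sum_lessThan_add:
  fixes g :: "nat \<Rightarrow> real"
  shows "(\<Sum>i<m + n. g i) = (\<Sum>i<m. g i) + (\<Sum>i<n. g (m + i))"
  by (induction n) simp_all

text \<open>The \<open>p\<close>-th power of the norm splits along the two blocks of rows. In the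
  lower block the factor \<open>b powr (1 / p)\<close> becomes \<open>b\<close> after raising to the
  power \<open>p\<close>.\<close>

lemma lp_norm_reduction:
  assumes \<Phi>: "two_sat_formula \<Phi>" and p: "1 \<le> p" and pos: "0 < b"
    and b: "rval \<theta> p (\<beta> (num_vars \<Phi>) (length (clauses \<Phi>))) = b"
    and red: "reduction \<theta> p \<beta> \<Phi> = (B, t, r)"
    and z: "z \<in> carrier_vec (num_vars \<Phi>)"
  shows "lp_norm p (B *\<^sub>v map_vec real_of_int z - t) =
    ((\<Sum>i<length (clauses \<Phi>). \<bar>real_of_int (clause_coord (\<lambda>j. z $ j) (clauses \<Phi> ! i))\<bar> powr p) +
     (\<Sum>i<num_vars \<Phi>. b * \<bar>real_of_int (z $ i)\<bar> powr p)) powr (1 / p)"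
proof -
  define n m where "n = num_vars \<Phi>" and "m = length (clauses \<Phi>)"
  let ?x = "B *\<^sub>v map_vec real_of_int z - t"
  have B: "B = mat (m + n) n (\<lambda>(i, j). rval \<theta> p (matrix_entry (\<beta> n m) \<Phi> i j))"
    and t: "t = vec (m + n) (\<lambda>i. rval \<theta> p (target_entry \<Phi> i))"
    using red by (auto simp: reduction_def Let_def n_def m_def)
  have zn: "z \<in> carrier_vec n" using z n_def by simp
  have entry: "?x $ i = (\<Sum>j<n. rval \<theta> p (matrix_entry (\<beta> n m) \<Phi> i j) * real_of_int (z $ j))
      - rval \<theta> p (target_entry \<Phi> i)" if "i < m + n" for i
    using that zn by (simp add: B t scalar_prod_def atLeast0LessThan)
  have upper: "?x $ i = real_of_int (clause_coord (\<lambda>j. z $ j) (clauses \<Phi> ! i))" if "i < m" for i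
  proof -
    have "\<forall>l \<in> set (clauses \<Phi> ! i). lit_var l < n"
      using \<Phi> that nth_mem[of i "clauses \<Phi>"] unfolding two_sat_formula_def m_def n_def by blast
    from arg_cong[OF clause_coord_eq[OF this, of "\<lambda>j. z $ j"], of real_of_int]
    show ?thesis
      using that by (simp add: entry matrix_entry_def target_entry_def flip: m_def)
  qed
  have lower: "?x $ (m + i) = b powr (1 / p) * real_of_int (z $ i)" if "i < n" for i
  proof -
    have "(\<Sum>j<n. rval \<theta> p (matrix_entry (\<beta> n m) \<Phi> (m + i) j) * real_of_int (z $ j)) =
        (\<Sum>j<n. if j = i then b powr (1 / p) * real_of_int (z $ j) else 0)"
      using b by (intro sum.cong) (auto simp: matrix_entry_def Let_def m_def n_def)
    then show ?thesis
      using that by (simp add: entry target_entry_def flip: m_def)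
  qed
  have "dim_vec ?x = m + n" by (simp add: B t)
  moreover have "(\<Sum>i<n. \<bar>?x $ (m + i)\<bar> powr p) = (\<Sum>i<n. b * \<bar>real_of_int (z $ i)\<bar> powr p)"
    using p pos by (intro sum.cong) (simp_all add: lower abs_mult powr_mult powr_powr)
  moreover have "(\<Sum>i<m. \<bar>?x $ i\<bar> powr p) =
      (\<Sum>i<m. \<bar>real_of_int (clause_coord (\<lambda>j. z $ j) (clauses \<Phi> ! i))\<bar> powr p)"
    by (intro sum.cong) (simp_all only: upper lessThan_iff)
  ultimately show ?thesis
    unfolding lp_norm_def m_def[symmetric] n_def[symmetric] by (simp only: sum_lessThan_add)
qed

text \<open>The lower block is a nonzero multiple of the identity, which forces full column rank
  whatever the clause rows are. The radius is positive because there is at least one clause.\<close>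

lemma cvp_instance_reduction:
  assumes \<Phi>: "two_sat_formula \<Phi>" and p: "1 \<le> p" and eps: "0 \<le> \<epsilon>" "\<epsilon> \<le> 1"
    and pos: "0 < rval [\<delta>, \<epsilon>, p] p (\<beta> (num_vars \<Phi>) (length (clauses \<Phi>)))"
  shows "cvp_instance (num_vars \<Phi>) (reduction [\<delta>, \<epsilon>, p] p \<beta> \<Phi>)"
proof -
  define n m where "n = num_vars \<Phi>" and "m = length (clauses \<Phi>)"
  let ?\<theta> = "[\<delta>, \<epsilon>, p]"
  define B where "B = mat (m + n) n (\<lambda>(i, j). rval ?\<theta> p (matrix_entry (\<beta> n m) \<Phi> i j))"
  have "m > 0" using \<Phi> by (simp add: two_sat_formula_def m_def)
  have "0 < \<epsilon> + (1 - \<epsilon>) * 3 powr p"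
    using eps by (cases "\<epsilon> = 0") (auto intro: add_pos_nonneg)
  then have "0 < n * rval ?\<theta> p (\<beta> n m) + m * (\<epsilon> + (1 - \<epsilon>) * 3 powr p)"
    using pos \<open>m > 0\<close> by (intro add_nonneg_pos) (simp_all add: n_def m_def)
  then have "0 < rval ?\<theta> p (radius (\<beta> n m) n m)"
    by (simp add: radius_def)
  moreover have "lin_indep_cols B"
    unfolding lin_indep_cols_def
  proof (intro ballI impI eq_vecI)
    fix x i
    assume x: "x \<in> carrier_vec (dim_col B)" and 0: "B *\<^sub>v x = 0\<^sub>v (dim_row B)"
      and "i < dim_vec (0\<^sub>v (dim_col B))"
    then have i: "i < n" and xn: "x \<in> carrier_vec n" by (simp_all add: B_def)
    \<comment> \<open>Coordinate \<open>m + i\<close> of the zero vector reads off a nonzero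
      multiple of \<open>x $ i\<close>.\<close>
    have "0 = (B *\<^sub>v x) $ (m + i)" using i by (simp add: 0) (simp add: B_def)
    also have "\<dots> = (\<Sum>j<n. rval ?\<theta> p (matrix_entry (\<beta> n m) \<Phi> (m + i) j) * x $ j)"
      using i xn by (simp add: B_def scalar_prod_def atLeast0LessThan)
    also have "\<dots> = (\<Sum>j<n. if j = i then rval ?\<theta> p (\<beta> n m) powr (1 / p) * x $ j else 0)"
      by (intro sum.cong) (auto simp: matrix_entry_def Let_def m_def)
    finally show "x $ i = 0\<^sub>v (dim_col B) $ i"
      using i pos by (auto simp: B_def n_def m_def)
  qed (auto simp: B_def)
  moreover have "dim_col B = n" "dim_row B = m + n" by (simp_all add: B_def)
  ultimately show ?thesis
    unfolding reduction_def Let_def n_def[symmetric] m_def[symmetric] B_def[symmetric] by simp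
qed


section \<open>Completeness and soundness of the reduction\<close>

lemma bdd_below_lp_norm: "bdd_below ((\<lambda>x. lp_norm p (x - t)) ` L)"
  by (rule bdd_belowI[of _ 0]) (auto simp: lp_norm_def)

text \<open>There are infinitely many assignments, but only finitely many possible counts of
  satisfied clauses, so \<open>Max\<close> ranges over a finite set.\<close>

lemma sat_val_attained: "\<exists>a. sat_val \<Phi> = sat_fraction a \<Phi>"
  and sat_fraction_le_sat_val: "sat_fraction a \<Phi> \<le> sat_val \<Phi>"
proof -
  let ?F = "range (\<lambda>a. sat_fraction a \<Phi>)"
  have "?F \<subseteq> (\<lambda>k. real k / real (length (clauses \<Phi>))) ` {..length (clauses \<Phi>)}"
    by (auto simp: sat_fraction_def)
  then have fin: "finite ?F" by (rule finite_subset) simp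
  then show "\<exists>a. sat_val \<Phi> = sat_fraction a \<Phi>"
    using Max_in[OF fin] unfolding sat_val_def by blast
  show "sat_fraction a \<Phi> \<le> sat_val \<Phi>"
    unfolding sat_val_def using fin by (intro Max_ge) auto
qed

text \<open>The 0/1 vector of an optimal assignment is close enough: its clause rows attain
  \<open>1\<close> or \<open>3\<close>, and its weight rows cost at most \<open>n * b\<close>, which
  the radius allows for. Smallness of \<open>b\<close> is not at issue in this direction.\<close>

lemma reduction_yes:
  assumes \<Phi>: "two_sat_formula \<Phi>" and p: "1 \<le> p"
    and pos: "0 < rval [\<delta>, \<epsilon>, p] p (\<beta> (num_vars \<Phi>) (length (clauses \<Phi>)))"
    and val: "\<epsilon> \<le> sat_val \<Phi>"
    and red: "reduction [\<delta>, \<epsilon>, p] p \<beta> \<Phi> = (B, t, r)"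
  shows "lp_dist p (lattice_of_basis B) t \<le> r"
proof -
  define n m where "n = num_vars \<Phi>" and "m = length (clauses \<Phi>)"
  define b where "b = rval [\<delta>, \<epsilon>, p] p (\<beta> n m)"
  have b: "0 < b" using pos by (simp add: b_def n_def m_def)
  have m: "0 < m" using \<Phi> by (simp add: two_sat_formula_def m_def)
  obtain a where a: "\<epsilon> \<le> sat_fraction a \<Phi>" using val sat_val_attained by metis
  define k where "k = length (filter (clause_true a) (clauses \<Phi>))"
  have k: "\<epsilon> * m \<le> k"
    using a m by (simp add: sat_fraction_def k_def m_def field_simps)
  define z :: "int vec" where "z = vec n (\<lambda>j. of_bool (a j))"
  have z: "z \<in> carrier_vec n" by (simp add: z_def)
  have coord: "clause_coord (\<lambda>j. z $ j) C = clause_coord (\<lambda>j. of_bool (a j)) C"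
    if "C \<in> set (clauses \<Phi>)" for C
  proof -
    have "lit_val (\<lambda>j. z $ j) l = lit_val (\<lambda>j. of_bool (a j)) l" if "lit_var l < n" for l
      using that by (cases l) (simp_all add: z_def)
    then have "map (lit_val (\<lambda>j. z $ j)) C = map (lit_val (\<lambda>j. of_bool (a j))) C"
      using \<Phi> that by (auto simp: two_sat_formula_def n_def)
    then show ?thesis by (simp only: clause_coord_def)
  qed
  have "(\<Sum>i<m. \<bar>real_of_int (clause_coord (\<lambda>j. z $ j) (clauses \<Phi> ! i))\<bar> powr p) =
    (\<Sum>i<m. if clause_true a (clauses \<Phi> ! i) then 1 else 3 powr p)"
  proof (intro sum.cong refl)
    fix i assume "i \<in> {..<m}"
    then have mem: "clauses \<Phi> ! i \<in> set (clauses \<Phi>)" by (simp add: m_def)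
    then have "length (clauses \<Phi> ! i) \<le> 2" using \<Phi> by (simp add: two_sat_formula_def)
    then have "\<bar>clause_coord (\<lambda>j. z $ j) (clauses \<Phi> ! i)\<bar> =
        (if clause_true a (clauses \<Phi> ! i) then 1 else 3)"
      by (simp only: coord[OF mem] abs_clause_coord_of_bool)
    from arg_cong[OF this, of real_of_int]
    show "\<bar>real_of_int (clause_coord (\<lambda>j. z $ j) (clauses \<Phi> ! i))\<bar> powr p =
        (if clause_true a (clauses \<Phi> ! i) then 1 else 3 powr p)" by simp
  qed
  also have "\<dots> = k + (real m - k) * 3 powr p"
    unfolding m_def k_def sum_nth_if by simp
  also have "\<dots> \<le> m * (\<epsilon> + (1 - \<epsilon>) * 3 powr p)"
  proof -
    \<comment> \<open>This product is exactly the difference of the two sides.\<close>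
    have "0 \<le> (k - \<epsilon> * m) * (3 powr p - 1)"
      using k p by (intro mult_nonneg_nonneg) (auto simp: ge_one_powr_ge_zero)
    then show ?thesis by (simp add: algebra_simps)
  qed
  finally have "(\<Sum>i<m. \<bar>real_of_int (clause_coord (\<lambda>j. z $ j) (clauses \<Phi> ! i))\<bar> powr p)
    \<le> m * (\<epsilon> + (1 - \<epsilon>) * 3 powr p)" .
  moreover have "(\<Sum>i<n. b * \<bar>real_of_int (z $ i)\<bar> powr p) \<le> (\<Sum>i<n. b)"
    using b by (intro sum_mono) (auto simp: z_def)
  ultimately have "lp_norm p (B *\<^sub>v map_vec real_of_int z - t) \<le>
      (m * (\<epsilon> + (1 - \<epsilon>) * 3 powr p) + n * b) powr (1 / p)"
    using lp_norm_reduction[where z = z and b = b, OF \<Phi> p b _ red] z b p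
    by (auto simp: b_def n_def m_def intro!: powr_mono2 add_mono add_nonneg_nonneg sum_nonneg)
  also have "\<dots> = r"
    using red by (auto simp: reduction_def Let_def radius_def b_def n_def m_def add.commute)
  finally have le: "lp_norm p (B *\<^sub>v map_vec real_of_int z - t) \<le> r" .
  have "dim_col B = n" using red by (auto simp: reduction_def Let_def n_def)
  then have "B *\<^sub>v map_vec real_of_int z \<in> lattice_of_basis B"
    using z by (auto simp: lattice_of_basis_def)
  from cINF_lower[OF bdd_below_lp_norm this] le
  show ?thesis unfolding lp_dist_def by (rule order_trans)
qed

text \<open>Writing \<open>N\<close> and \<open>E\<close> for numerator and denominator of the ratio
  in \<gamma>, the \<open>p\<close>-th power of \<open>\<gamma> * r\<close> is \<open>m * N\<close>
  plus the error \<open>N / E * (n * b)\<close>. Assumption \<open>small\<close> keeps this error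
  below the gap between \<open>m * N\<close> and the least possible cost of the clause rows.\<close>

lemma reduction_no:
  fixes \<gamma> \<delta> \<epsilon> p :: real
  assumes \<Phi>: "two_sat_formula \<Phi>" and p: "1 \<le> p" and eps: "0 \<le> \<epsilon>" "\<epsilon> \<le> 1"
    and delta: "0 \<le> \<delta>" "\<delta> \<le> 1"
    and gamma: "\<gamma> = ((\<delta> + (1 - \<delta>) * 3 powr p) / (\<epsilon> + (1 - \<epsilon>) * 3 powr p)) powr (1 / p)"
    and pos: "0 < rval [\<delta>, \<epsilon>, p] p (\<beta> (num_vars \<Phi>) (length (clauses \<Phi>)))"
    and small: "\<And>k::nat. k < \<delta> * length (clauses \<Phi>) \<Longrightarrow>
      num_vars \<Phi> * 3 powr p * rval [\<delta>, \<epsilon>, p] p (\<beta> (num_vars \<Phi>) (length (clauses \<Phi>)))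
        < \<delta> * length (clauses \<Phi>) - k"
    and val: "sat_val \<Phi> < \<delta>"
    and red: "reduction [\<delta>, \<epsilon>, p] p \<beta> \<Phi> = (B, t, r)"
  shows "\<gamma> * r < lp_dist p (lattice_of_basis B) t"
proof -
  define n m where "n = num_vars \<Phi>" and "m = length (clauses \<Phi>)"
  define b where "b = rval [\<delta>, \<epsilon>, p] p (\<beta> n m)"
  define N E where "N = \<delta> + (1 - \<delta>) * 3 powr p" and "E = \<epsilon> + (1 - \<epsilon>) * 3 powr p"
  have b: "0 < b" using pos by (simp add: b_def n_def m_def)
  have m: "0 < m" using \<Phi> by (simp add: two_sat_formula_def m_def)
  have three: "3 \<le> (3::real) powr p" using powr_mono[OF p, of 3] by simp
  have E: "1 \<le> E"
    using mult_left_mono[of 1 "3 powr p" "1 - \<epsilon>"] eps three by (simp add: E_def)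
  have N: "0 < N" "N \<le> 3 powr p"
    using mult_left_mono[of 1 "3 powr p" "1 - \<delta>"] mult_left_mono[of 1 "3 powr p" "\<delta>"] delta three
    by (simp_all add: N_def algebra_simps)
  obtain a where a: "sat_val \<Phi> = sat_fraction a \<Phi>" using sat_val_attained by metis
  define k where "k = length (filter (clause_true a) (clauses \<Phi>))"
  have "sat_fraction a \<Phi> < \<delta>" using a val by simp
  then have k: "k < \<delta> * m"
    using m by (simp add: sat_fraction_def k_def m_def field_simps)
  have max: "length (filter (clause_true a') (clauses \<Phi>)) \<le> k" for a'
    using sat_fraction_le_sat_val[of a' \<Phi>] m unfolding a
    by (simp add: sat_fraction_def k_def m_def divide_le_cancel)
  have "\<gamma> * r = (N / E * (n * b + m * E)) powr (1 / p)"
    using red E N b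
    by (auto simp: gamma reduction_def Let_def radius_def powr_mult[symmetric] N_def[symmetric]
        E_def[symmetric] b_def n_def m_def)
  \<comment> \<open>Strictness is secured here, against a bound common to all lattice points,
    because passing to the infimum afterwards yields only a weak inequality.\<close>
  also have "\<dots> < (k + (real m - k) * 3 powr p) powr (1 / p)"
  proof (rule powr_less_mono2)
    have "N / E * (n * b + m * E) = N / E * (n * b) + m * N"
      using E by (simp add: field_simps)
    also have "N / E * (n * b) \<le> 3 powr p * (n * b)"
    proof (rule mult_right_mono)
      have "N / E \<le> N / 1" using E N by (intro divide_left_mono) auto
      then show "N / E \<le> 3 powr p" using N by simp
    qed (use b in simp)
    also have "3 powr p * (n * b) < \<delta> * m - k"
      using small[of k] k by (simp add: b_def n_def m_def ac_simps)
    \<comment> \<open>Since \<open>3 powr p - 1\<close> is at least \<open>1\<close>; the right side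
      is precisely the gap \<open>k + (m - k) * 3 powr p - m * N\<close>.\<close>
    also have "\<delta> * m - k \<le> (\<delta> * m - k) * (3 powr p - 1)"
      using mult_left_mono[of 1 "3 powr p - 1" "\<delta> * m - k"] k three by simp
    finally show "N / E * (n * b + m * E) < k + (real m - k) * 3 powr p"
      by (simp add: N_def algebra_simps)
    show "0 \<le> N / E * (n * b + m * E)" using N E b by simp
  qed (use p in simp)
  also have "\<dots> \<le> lp_dist p (lattice_of_basis B) t"
    unfolding lp_dist_def
  proof (rule cINF_greatest)
    show "lattice_of_basis B \<noteq> {}"
      unfolding lattice_of_basis_def using zero_carrier_vec by blast
    fix x assume "x \<in> lattice_of_basis B"
    moreover have "dim_col B = n" using red by (auto simp: reduction_def Let_def n_def)
    ultimately obtain z where z: "z \<in> carrier_vec n" and x: "x = B *\<^sub>v map_vec real_of_int z"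
      by (auto simp: lattice_of_basis_def)
    \<comment> \<open>Rounding an arbitrary lattice coefficient vector gives an assignment, which
      satisfies at most the optimal number \<open>k\<close> of clauses. Fewer satisfied clauses only
      increase the cost.\<close>
    define a' where "a' = (\<lambda>v. 1 \<le> z $ v)"
    define k' where "k' = length (filter (clause_true a') (clauses \<Phi>))"
    have "0 \<le> (real k - k') * (3 powr p - 1)"
      using max[of a'] three by (intro mult_nonneg_nonneg) (auto simp: k'_def)
    then have "k + (real m - k) * 3 powr p \<le> k' + (real m - k') * 3 powr p"
      by (simp add: algebra_simps)
    also have "\<dots> = (\<Sum>i<m. if clause_true a' (clauses \<Phi> ! i) then 1 else 3 powr p)"
      unfolding m_def k'_def sum_nth_if by simp
    also have "\<dots> \<le> (\<Sum>i<m. \<bar>real_of_int (clause_coord (\<lambda>j. z $ j) (clauses \<Phi> ! i))\<bar> powr p)"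
    proof (rule sum_mono)
      fix i
      have 1: "1 \<le> \<bar>real_of_int (clause_coord (\<lambda>j. z $ j) (clauses \<Phi> ! i))\<bar>"
        using abs_clause_coord_ge_1[of "\<lambda>j. z $ j" "clauses \<Phi> ! i"] by linarith
      have 3: "3 \<le> \<bar>real_of_int (clause_coord (\<lambda>j. z $ j) (clauses \<Phi> ! i))\<bar>"
        if "\<not> clause_true a' (clauses \<Phi> ! i)"
        using abs_clause_coord_ge_3[OF that[unfolded a'_def]] by linarith
      show "(if clause_true a' (clauses \<Phi> ! i) then 1 else 3 powr p) \<le>
          \<bar>real_of_int (clause_coord (\<lambda>j. z $ j) (clauses \<Phi> ! i))\<bar> powr p"
        using 1 3 p by (auto intro: ge_one_powr_ge_zero powr_mono2)
    qed
    also have "\<dots> \<le> \<dots> + (\<Sum>i<n. b * \<bar>real_of_int (z $ i)\<bar> powr p)"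
      using b by (simp add: sum_nonneg)
    finally have "(k + (real m - k) * 3 powr p) powr (1 / p) \<le>
        ((\<Sum>i<m. \<bar>real_of_int (clause_coord (\<lambda>j. z $ j) (clauses \<Phi> ! i))\<bar> powr p) +
         (\<Sum>i<n. b * \<bar>real_of_int (z $ i)\<bar> powr p)) powr (1 / p)"
      using p by (intro powr_mono2) (auto simp: k_def m_def)
    also have "\<dots> = lp_norm p (x - t)"
      using lp_norm_reduction[where z = z and b = b, OF \<Phi> p b _ red] z
      by (simp add: x b_def n_def m_def)
    finally show "(k + (real m - k) * 3 powr p) powr (1 / p) \<le> lp_norm p (x - t)" .
  qed
  finally show ?thesis .
qed

section \<open>A closed expression lying below every positive gap\<close>

section \<open>The weight of the rows that ensure linear independence\<close>

text \<open>The reciprocal of this sum is at most each \<open>(\<delta> * m - k)^2 + a / b\<close>,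
  so it replaces a minimum over \<open>k\<close>. Expressions have no comparisons, and the machine
  cannot inspect \<delta>, which is \<open>RParam 0\<close>.\<close>

definition inv_sq_sum :: "nat \<Rightarrow> nat \<Rightarrow> nat \<Rightarrow> rexp" where
  "inv_sq_sum a b m = foldr (\<lambda>k e. RAdd (RDiv (RNat 1)
     (RAdd (RMul (RSub (RMul (RParam 0) (RNat m)) (RNat k)) (RSub (RMul (RParam 0) (RNat m)) (RNat k)))
       (RDiv (RNat a) (RNat b)))) e) [0..<m] (RNat 0)"

text \<open>The factor \<open>RPow 3\<close> cancels the loss \<open>3 powr p\<close> of the
  soundness bound. Using \<open>n + 1\<close> avoids division by zero for \<open>n = 0\<close> and
  makes the final estimate strict.\<close>

definition weight :: "nat \<Rightarrow> nat \<Rightarrow> nat \<Rightarrow> nat \<Rightarrow> rexp" where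
  "weight a b n m = RDiv (RNat 1)
     (RMul (RMul (RNat (m + m)) (RMul (RPow 3) (RNat (n + 1)))) (inv_sq_sum a b m))"

lemma rval_inv_sq_sum:
  "rval (\<delta> # \<theta>) p (inv_sq_sum a b m) = (\<Sum>k<m. 1 / ((\<delta> * m - real k)\<^sup>2 + a / b))"
proof -
  have "rval \<theta>' p (foldr (\<lambda>k e. RAdd (g k) e) xs (RNat 0)) = (\<Sum>k\<leftarrow>xs. rval \<theta>' p (g k))"
    for \<theta>' g and xs :: "nat list"
    by (induction xs) auto
  then show ?thesis
    by (simp add: inv_sq_sum_def interv_sum_list_conv_sum_set_nat atLeast0LessThan power2_eq_square)
qed

text \<open>For \<delta> = c/d, a positive \<open>\<delta> * m - k\<close> is a positive integer
  over \<open>d\<close>, so at least \<open>1 / d\<close>. For irrational \<delta> and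
  \<open>m > 0\<close> the square never vanishes, and \<open>a = 0\<close> works. The case split
  need not be computable, as \<open>a\<close> and \<open>b\<close> depend on \<delta> alone.\<close>

lemma separation_constant:
  fixes \<delta> :: real
  shows "\<exists>(a :: nat) (b :: nat). \<forall>m :: nat. (0 :: nat) < m \<longrightarrow> (\<forall>k :: nat. 0 < (\<delta> * m - k)\<^sup>2 + a / b \<and>
    (k < \<delta> * m \<longrightarrow> a / b \<le> \<delta> * m - k))"
proof (cases "\<delta> \<in> \<rat>")
  case True
  then obtain c d where d: "(0::int) < d" and \<delta>: "\<delta> = of_int c / of_int d"
    by (rule Rats_cases')
  have "1 / real (nat d) \<le> \<delta> * m - k" if "real k < \<delta> * m" for m k :: nat
  proof -
    have eq: "\<delta> * m - k = of_int (c * m - k * d) / of_int d"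
      using d by (simp add: \<delta> field_simps)
    have "0 < of_int (c * m - k * d) / (of_int d :: real)"
      using that unfolding eq[symmetric] by simp
    then have "0 < real_of_int (c * m - k * d)" using d by (simp only: zero_less_divide_iff) auto
    then have "1 \<le> c * m - k * d" by (simp only: of_int_0_less_iff)
    then have "1 \<le> real_of_int (c * m - k * d)" by (simp only: of_int_1_le_iff)
    then show ?thesis using d by (simp add: eq divide_right_mono)
  qed
  then show ?thesis
    using d by - (rule exI[of _ 1], rule exI[of _ "nat d"], simp add: add_nonneg_pos)
next
  case False
  have "\<delta> * m \<noteq> k" if "m > 0" for m k :: nat
  proof
    assume "\<delta> * m = k"
    then have "\<delta> = real k / real m" using that by (simp add: field_simps)
    then show False using False by simp
  qed
  then show ?thesis by (intro exI[of _ 0]) simp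
qed

text \<open>With \<open>y = \<delta> * m - k\<close>, both \<open>y^2\<close> and
  \<open>a / b\<close> are at most \<open>m * y\<close>. So the summand for this \<open>k\<close> is
  at least \<open>1 / (2 * m * y)\<close>, and \<open>1 / (2 * m * D)\<close> is at most
  \<open>y\<close>.\<close>

lemma weight_bounds:
  fixes a b n m k :: nat and \<delta> :: real
  assumes delta: "\<delta> \<le> 1" and m: "0 < m"
    and ab: "\<forall>k :: nat. 0 < (\<delta> * m - k)\<^sup>2 + a / b \<and> (k < \<delta> * m \<longrightarrow> a / b \<le> \<delta> * m - k)"
  shows "0 < rval (\<delta> # \<theta>) p (weight a b n m)"
    and "k < \<delta> * m \<Longrightarrow> n * 3 powr p * rval (\<delta> # \<theta>) p (weight a b n m) < \<delta> * m - k"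
proof -
  define D where "D = (\<Sum>k<m. 1 / ((\<delta> * m - real k)\<^sup>2 + a / b))"
  have D: "0 < D" unfolding D_def using m ab by (intro sum_pos) auto
  have w: "rval (\<delta> # \<theta>) p (weight a b n m) = 1 / (2 * m * (3 powr p * (n + 1)) * D)"
    by (simp add: weight_def rval_inv_sq_sum D_def algebra_simps)
  show "0 < rval (\<delta> # \<theta>) p (weight a b n m)" using D m by (simp add: w)
  assume k: "k < \<delta> * m"
  define y where "y = \<delta> * m - k"
  have y: "0 < y" "y \<le> m"
    using k mult_right_mono[OF delta, of m] by (auto simp: y_def)
  \<comment> \<open>This puts the given \<open>k\<close> within the range of summation of
    \<open>D\<close>.\<close>
  have "k < m" using k mult_right_mono[OF delta, of m] by simp
  have "y\<^sup>2 + a / b \<le> 2 * m * y"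
  proof -
    have "a / b \<le> 1 * y" using ab k by (simp add: y_def)
    also have "\<dots> \<le> m * y" using m y by (intro mult_right_mono) auto
    finally show ?thesis using mult_right_mono[OF y(2), of y] y unfolding power2_eq_square by linarith
  qed
  then have "1 / (2 * m * y) \<le> 1 / (y\<^sup>2 + a / b)"
    using ab y m by (intro divide_left_mono) (auto simp: y_def)
  also have "\<dots> \<le> D"
    unfolding D_def y_def using \<open>k < m\<close> ab
    by (intro member_le_sum[of k "{..<m}" "\<lambda>k. 1 / ((\<delta> * m - real k)\<^sup>2 + a / b)"]) (auto simp: less_imp_le)
  finally have "1 / (2 * m * D) \<le> y" using y m D by (simp add: field_simps)
  moreover have "n * 3 powr p * rval (\<delta> # \<theta>) p (weight a b n m) = n / (n + 1) * (1 / (2 * m * D))"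
    by (simp add: w)
  moreover have "n / (n + 1) * (1 / (2 * m * D)) < 1 * (1 / (2 * m * D))"
    using m D by (intro mult_strict_right_mono) auto
  ultimately show "n * 3 powr p * rval (\<delta> # \<theta>) p (weight a b n m) < \<delta> * m - k"
    by (simp add: y_def)
qed


section \<open>Programs emitting the instance in prefix notation\<close>

section \<open>The program\<close>

abbreviation vars_exp :: aexp where "vars_exp \<equiv> Read 0 (Num 0)"
abbreviation clauses_exp :: aexp where "clauses_exp \<equiv> Read 0 (Num 1)"

text \<open>The address is \<open>4 * i + 2 + s\<close>, with the product built from additions:
  blocks have four cells, and the first two cells of the input hold \<open>n\<close> and
  \<open>m\<close>.\<close>

definition clause_cell :: "aexp \<Rightarrow> nat \<Rightarrow> aexp" where
  "clause_cell i s = Read 0 (Add (Add (Add i i) (Add i i)) (Num (2 + s)))"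

definition abs_diff :: "aexp \<Rightarrow> aexp \<Rightarrow> aexp" where
  "abs_diff a b = Add (Sub a b) (Sub b a)"

text \<open>By truncation the value is \<open>1\<close> if the literal at offset \<open>s\<close> of the block of clause \<open>i\<close> has
  tag \<open>t\<close> and variable \<open>j\<close>, and \<open>0\<close> otherwise.\<close>

definition literal_test :: "nat \<Rightarrow> aexp \<Rightarrow> nat \<Rightarrow> aexp \<Rightarrow> aexp" where
  "literal_test t i s j =
     Sub (Num 1) (Add (abs_diff (clause_cell i s) (Num t)) (abs_diff (clause_cell i (s + 1)) j))"

text \<open>Offsets 0 and 2 are the two literal slots of a block. A padded slot has tag 0 and so
  matches neither tag 1 nor tag 2.\<close>

definition twice_count :: "nat \<Rightarrow> aexp \<Rightarrow> aexp \<Rightarrow> aexp" where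
  "twice_count t i j = Add (Add (literal_test t i 0 j) (literal_test t i 2 j))
     (Add (literal_test t i 0 j) (literal_test t i 2 j))"

text \<open>Truncated subtraction sends tag 2 to \<open>1\<close>, and both tag 1 and the padding
  tag 0 to \<open>0\<close>.\<close>

definition twice_num_neg :: "aexp \<Rightarrow> aexp" where
  "twice_num_neg i =
     Add (Add (Sub (clause_cell i 0) (Num 1)) (Sub (clause_cell i 2) (Num 1)))
         (Add (Sub (clause_cell i 0) (Num 1)) (Sub (clause_cell i 2) (Num 1)))"

text \<open>In prefix code a right-nested sum is the sequence of its summands, each preceded by the
  tag 3, closed by the code of \<open>RNat 0\<close>. One loop without a stack therefore emits
  it.\<close>

definition weight_com :: "nat \<Rightarrow> nat \<Rightarrow> com" where
  "weight_com a b =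
     Seq (emit_all [Num 6, Num 0, Num 1, Num 5, Num 5, Num 0, Add clauses_exp clauses_exp,
       Num 5, Num 2, Num 3, Num 0, Add vars_exp (Num 1)])
    (Seq (for_less 3 clauses_exp (emit_all [Num 3, Num 6, Num 0, Num 1, Num 3, Num 5,
       Num 4, Num 5, Num 1, Num 0, Num 0, clauses_exp, Num 0, counter 3,
       Num 4, Num 5, Num 1, Num 0, Num 0, clauses_exp, Num 0, counter 3,
       Num 6, Num 0, Num a, Num 0, Num b]))
      (emit_all [Num 0, Num 0]))"

definition clause_rows_com :: com where
  "clause_rows_com = for_less 1 clauses_exp (for_less 2 vars_exp (emit_all [Num 4,
     Num 0, twice_count 1 (counter 1) (counter 2), Num 0, twice_count 2 (counter 1) (counter 2)]))"

text \<open>The test \<open>abs_diff < 1\<close> decides equality of the indices. The weight is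
  emitted anew for every diagonal entry since expressions admit no sharing.\<close>

definition weight_rows_com :: "nat \<Rightarrow> nat \<Rightarrow> com" where
  "weight_rows_com a b = for_less 1 vars_exp (for_less 2 vars_exp
     (IfLess (abs_diff (counter 1) (counter 2)) (Num 1)
       (Seq (Emit (Num 7)) (weight_com a b)) (emit_all [Num 0, Num 0])))"

definition target_com :: com where
  "target_com =
     Seq (for_less 1 clauses_exp (emit_all [Num 4, Num 0, Num 3, Num 0, twice_num_neg (counter 1)]))
       (for_less 1 vars_exp (emit_all [Num 0, Num 0]))"

definition radius_com :: "nat \<Rightarrow> nat \<Rightarrow> com" where
  "radius_com a b =
     Seq (emit_all [Num 7, Num 3, Num 5, Num 0, vars_exp])
    (Seq (weight_com a b)
      (emit_all [Num 5, Num 0, clauses_exp, Num 3, Num 1, Num 1, Num 5, Num 4, Num 0, Num 1,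
         Num 1, Num 1, Num 2, Num 3]))"

definition reduction_com :: "nat \<Rightarrow> nat \<Rightarrow> com" where
  "reduction_com a b =
     Seq (emit_all [Add clauses_exp vars_exp, vars_exp])
    (Seq clause_rows_com (Seq (weight_rows_com a b) (Seq target_com (radius_com a b))))"

section \<open>Correctness and running time of the programs\<close>

lemma nth_concat_blocks:
  assumes "\<forall>x \<in> set xs. length (g x) = w" "i < length xs" "s < w"
  shows "concat (map g xs) ! (i * w + s) = g (xs ! i) ! s"
  using assms
proof (induction xs arbitrary: i)
  case (Cons x xs)
  then show ?case by (cases i) (simp_all add: nth_append algebra_simps)
qed simp

lemma length_clause_code: "length C \<le> 2 \<Longrightarrow> length (clause_code C) = 4"
proof -
  have "length (lit_code l) = 2" for l by (cases l) auto
  then have "length (concat (map lit_code C)) = 2 * length C" by (induction C) auto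
  then show "length C \<le> 2 \<Longrightarrow> length (clause_code C) = 4" by (simp add: clause_code_def)
qed

text \<open>Here \<open>w\<close> is the initial content of array 0. No program writes that array,
  so the assumption \<open>s 0 = w\<close> of the lemmas below survives sequencing and
  loops.\<close>

locale input =
  fixes \<Phi> :: cnf and w :: "nat \<Rightarrow> nat" and n m :: nat
  assumes \<Phi>: "two_sat_formula \<Phi>"
  defines "n \<equiv> num_vars \<Phi>" and "m \<equiv> length (clauses \<Phi>)"
    and "w \<equiv> input_store (cnf_code \<Phi>) 0"
begin

lemma w_vars: "w 0 = n" and w_clauses: "w (Suc 0) = m"
  by (simp_all add: w_def n_def m_def input_store_def cnf_code_def)

lemma aval_clause_cell:
  assumes "s 0 = w" "aval i s = k" "k < m" "x < 4"
  shows "aval (clause_cell i x) s = clause_code (clauses \<Phi> ! k) ! x"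
proof -
  have len: "\<forall>C \<in> set (clauses \<Phi>). length (clause_code C) = 4"
    using \<Phi> by (auto simp: two_sat_formula_def intro!: length_clause_code)
  have "length (concat (map clause_code (clauses \<Phi>))) = m * 4"
    using len unfolding m_def by (induction "clauses \<Phi>") (auto simp: length_concat sum_list_triv cong: map_cong)
  moreover have "k * 4 + x < m * 4" using assms by linarith
  moreover have "aval (clause_cell i x) s = w (Suc (Suc (k * 4 + x)))"
  proof -
    have "k + k + (k + k) + (2 + x) = Suc (Suc (k * 4 + x))" by simp
    then show ?thesis using assms by (simp only: clause_cell_def aval.simps)
  qed
  ultimately show ?thesis
    using nth_concat_blocks[OF len] assms
    by (simp add: w_def input_store_def cnf_code_def m_def)
qed

text \<open>A clause has zero, one or two literals; in each shape the four cells of its block are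
  known, and the arithmetic tests are evaluated on them.\<close>

lemma aval_twice_count:
  assumes "s 0 = w" "aval i s = k" "aval j s = v" "k < m"
  shows "aval (twice_count (Suc 0) i j) s = 2 * count_list (clauses \<Phi> ! k) (Pos v)"
    and "aval (twice_count 2 i j) s = 2 * count_list (clauses \<Phi> ! k) (Neg v)"
    and "aval (twice_num_neg i) s = 2 * num_neg (clauses \<Phi> ! k)"
proof -
  define C where "C = clauses \<Phi> ! k"
  have "length C \<le> 2"
    using \<Phi> assms(4) by (auto simp: two_sat_formula_def C_def m_def)
  then have C: "C = [] \<or> (\<exists>l. C = [l]) \<or> (\<exists>l l'. C = [l, l'])"
    by (cases C; cases "tl C"; cases "tl (tl C)") auto
  have cell: "aval (clause_cell i x) s = clause_code C ! x" if "x < 4" for x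
    using aval_clause_cell[OF assms(1,2,4) that] by (simp add: C_def)
  have lit: "lit_code l ! 0 = (if is_neg l then 2 else 1)" "lit_code l ! Suc 0 = lit_var l"
      "length (lit_code l) = 2" "l = Pos v \<longleftrightarrow> \<not> is_neg l \<and> lit_var l = v"
      "l = Neg v \<longleftrightarrow> is_neg l \<and> lit_var l = v" for l v
    by (cases l; simp)+
  have neq: "Suc 0 \<le> x - y + (y - x) \<longleftrightarrow> x \<noteq> y" for x y :: nat
    by auto
  have "aval (twice_count (Suc 0) i j) s = 2 * count_list C (Pos v) \<and>
    aval (twice_count 2 i j) s = 2 * count_list C (Neg v) \<and>
    aval (twice_num_neg i) s = 2 * num_neg C"
    using C
    by (elim disjE exE; simp add: twice_count_def literal_test_def abs_diff_def twice_num_neg_def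
        cell assms(3) clause_code_def numeral_2_eq_2 numeral_3_eq_3; simp add: nth_append lit neq)
  then show "aval (twice_count (Suc 0) i j) s = 2 * count_list (clauses \<Phi> ! k) (Pos v)"
    and "aval (twice_count 2 i j) s = 2 * count_list (clauses \<Phi> ! k) (Neg v)"
    and "aval (twice_num_neg i) s = 2 * num_neg (clauses \<Phi> ! k)"
    by (simp_all add: C_def)
qed

lemma runs_weight_com:
  assumes "s 0 = w" "{3} \<subseteq> W" "0 \<notin> W"
  shows "runs W s (weight_com a b) (30 * m + 18) (rexp_code (weight a b n m))"
proof -
  define summand where "summand k = RDiv (RNat 1)
     (RAdd (RMul (RSub (RMul (RParam 0) (RNat m)) (RNat k)) (RSub (RMul (RParam 0) (RNat m)) (RNat k)))
       (RDiv (RNat a) (RNat b)))" for k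
  have sum: "rexp_code (inv_sq_sum a b m) =
      concat (map (\<lambda>k. 3 # rexp_code (summand k)) [0..<m]) @ [0, 0]"
  proof -
    have "rexp_code (foldr (\<lambda>k e. RAdd (summand k) e) xs (RNat 0)) =
      concat (map (\<lambda>k. 3 # rexp_code (summand k)) xs) @ [0, 0]" for xs
      by (induction xs) auto
    then show ?thesis by (simp only: inv_sq_sum_def summand_def)
  qed
  let ?out = "[6, 0, 1, 5, 5, 0, m + m, 5, 2, 3, 0, n + 1] @
      concat (map (\<lambda>k. 3 # rexp_code (summand k)) [0..<m]) @ [0, 0]"
  \<comment> \<open>The three parts emit 12, \<open>m\<close> times 27, and 2 numbers; each
    \<open>emit_all\<close> costs one more step than its length.\<close>
  have "runs {3} s (weight_com a b) (13 + ((m * (28 + 2) + 2) + 3)) ?out"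
    unfolding weight_com_def
    by (intro runs_Seq runs_for_less runs_emit_all)
      (auto simp: assms w_vars w_clauses summand_def)
  moreover have "?out = rexp_code (weight a b n m)" by (simp add: weight_def sum)
  ultimately show ?thesis using assms by (auto intro: runs_mono)
qed

lemma runs_clause_rows_com:
  assumes "s 0 = w"
  shows "runs {1, 2, 3} s clause_rows_com (m * (n * 8 + 4) + 2)
    (concat (map (\<lambda>i. concat (map (\<lambda>j. rexp_code (matrix_entry \<beta> \<Phi> i j)) [0..<n])) [0..<m]))"
proof -
  have "runs {1, 2} s clause_rows_com (m * ((n * (6 + 2) + 2) + 2) + 2)
    (concat (map (\<lambda>i. concat (map (\<lambda>j. rexp_code (matrix_entry \<beta> \<Phi> i j)) [0..<n])) [0..<m]))"
    unfolding clause_rows_com_def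
    by (intro runs_for_less runs_emit_all)
      (auto simp: assms w_vars w_clauses aval_twice_count matrix_entry_def m_def[symmetric])
  then show ?thesis by (rule runs_mono) (auto simp: algebra_simps)
qed

lemma runs_weight_rows_com:
  assumes "s 0 = w"
  shows "runs {1, 2, 3} s (weight_rows_com a b) (n * (n * (30 * m + 22) + 4) + 2)
    (concat (map (\<lambda>i. concat (map (\<lambda>j. rexp_code (matrix_entry (weight a b n m) \<Phi> i j)) [0..<n]))
      [m..<m + n]))"
proof -
  have "[m..<m + n] = map (\<lambda>i. m + i) [0..<n]"
    using map_add_upt[of m n] by (simp add: add.commute)
  \<comment> \<open>The loop counter runs from 0, so its round \<open>i\<close> produces matrix row
    \<open>m + i\<close>.\<close>
  moreover have "runs {1, 2, 3} s (weight_rows_com a b)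
      (n * ((n * ((1 + (30 * m + 18) + 1) + 2) + 2) + 2) + 2)
    (concat (map (\<lambda>i. concat (map (\<lambda>j. rexp_code (matrix_entry (weight a b n m) \<Phi> (m + i) j)) [0..<n]))
      [0..<n]))"
    unfolding weight_rows_com_def
  proof (intro runs_for_less runs_IfLess)
    fix s' s'' i j
    assume s': "\<forall>y. y \<notin> {1, 2, 3} \<longrightarrow> s' y = s y" "s' 1 0 = i" "i < n"
      and s'': "\<forall>y. y \<notin> {2, 3} \<longrightarrow> s'' y = s' y" "s'' 2 0 = j" "j < n"
    let ?less = "aval (abs_diff (counter 1) (counter 2)) s'' < aval (Num 1) s''"
    have less: "?less \<longleftrightarrow> i = j"
      using s' s'' by (auto simp: abs_diff_def)
    have s0: "s'' 0 = w" using s' s'' assms by simp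
    show "runs {3} s'' (Seq (Emit (Num 7)) (weight_com a b)) (1 + (30 * m + 18))
      (rexp_code (matrix_entry (weight a b n m) \<Phi> (m + i) j))" if ?less
    proof -
      have "runs {3} s'' (Seq (Emit (Num 7)) (weight_com a b)) (1 + (30 * m + 18))
          ([aval (Num 7) s''] @ rexp_code (weight a b n m))"
        by (intro runs_Seq runs_Emit runs_weight_com) (simp_all add: s0)
      then show ?thesis using that less by (simp add: matrix_entry_def m_def[symmetric])
    qed
    show "runs {3} s'' (emit_all [Num 0, Num 0]) (1 + (30 * m + 18))
      (rexp_code (matrix_entry (weight a b n m) \<Phi> (m + i) j))" if "\<not> ?less"
      using that less
      by (intro runs_emit_all) (auto simp: matrix_entry_def m_def[symmetric])
  qed (use assms in \<open>auto simp: w_vars\<close>)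
  ultimately show ?thesis by (simp add: comp_def algebra_simps)
qed

lemma runs_target_com:
  assumes "s 0 = w"
  shows "runs {1, 2, 3} s target_com (m * 8 + n * 5 + 4)
    (concat (map (\<lambda>i. rexp_code (target_entry \<Phi> i)) [0..<m + n]))"
proof -
  have "runs {1} s target_com ((m * (6 + 2) + 2) + (n * (3 + 2) + 2))
    (concat (map (\<lambda>i. rexp_code (target_entry \<Phi> i)) [0..<m]) @
     concat (map (\<lambda>i. rexp_code (target_entry \<Phi> (m + i))) [0..<n]))"
    unfolding target_com_def
    by (intro runs_Seq runs_for_less runs_emit_all)
      (auto simp: assms w_vars w_clauses aval_twice_count target_entry_def m_def[symmetric])
  moreover have "[0..<m + n] = [0..<m] @ map (\<lambda>i. m + i) [0..<n]"
    using map_add_upt[of m n] upt_add_eq_append[of 0 m n] by (simp add: add.commute)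
  ultimately show ?thesis by (auto simp: comp_def intro: runs_mono)
qed

lemma runs_radius_com:
  assumes "s 0 = w"
  shows "runs {1, 2, 3} s (radius_com a b) (30 * m + 39) (rexp_code (radius (weight a b n m) n m))"
proof -
  have "runs {1, 2, 3} s (radius_com a b) (6 + ((30 * m + 18) + 15))
    ([7, 3, 5, 0, n] @ rexp_code (weight a b n m) @ [5, 0, m, 3, 1, 1, 5, 4, 0, 1, 1, 1, 2, 3])"
    unfolding radius_com_def
    by (intro runs_Seq runs_weight_com runs_emit_all)
      (auto simp: assms w_vars w_clauses)
  then show ?thesis by (simp add: radius_def add.commute)
qed

definition matrix_entries :: "rexp \<Rightarrow> rexp list" where
  "matrix_entries \<beta> = concat (map (\<lambda>i. map (matrix_entry \<beta> \<Phi> i) [0..<n]) [0..<m + n])"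

lemma runs_reduction_com:
  assumes "s 0 = w"
  shows "runs {1, 2, 3} s (reduction_com a b)
    (3 + (m * (n * 8 + 4) + 2 + (n * (n * (30 * m + 22) + 4) + 2 + (m * 8 + n * 5 + 4 + (30 * m + 39)))))
    ((m + n) # n # concat (map rexp_code (matrix_entries (weight a b n m) @
       map (target_entry \<Phi>) [0..<m + n] @ [radius (weight a b n m) n m])))"
proof -
  let ?\<beta> = "weight a b n m"
  let ?row = "\<lambda>i. concat (map (\<lambda>j. rexp_code (matrix_entry ?\<beta> \<Phi> i j)) [0..<n])"
  have rows: "concat (map rexp_code (matrix_entries ?\<beta>)) =
      concat (map ?row [0..<m]) @ concat (map ?row [m..<m + n])"
  proof -
    have "concat (map f (concat (map g xs))) = concat (map (\<lambda>x. concat (map f (g x))) xs)"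
      for f :: "rexp \<Rightarrow> nat list" and g and xs :: "nat list"
      by (induction xs) auto
    then show ?thesis
      by (simp add: matrix_entries_def comp_def upt_add_eq_append[of 0 m n])
  qed
  have "runs {1, 2, 3} s (reduction_com a b)
    (3 + (m * (n * 8 + 4) + 2 + (n * (n * (30 * m + 22) + 4) + 2 + (m * 8 + n * 5 + 4 + (30 * m + 39)))))
    ([m + n, n] @ concat (map ?row [0..<m]) @ concat (map ?row [m..<m + n]) @
      concat (map (\<lambda>i. rexp_code (target_entry \<Phi> i)) [0..<m + n]) @ rexp_code (radius ?\<beta> n m))"
    unfolding reduction_com_def
    by (intro runs_Seq runs_clause_rows_com runs_weight_rows_com runs_target_com runs_radius_com
        runs_emit_all) (simp_all add: assms w_vars w_clauses)
  then show ?thesis by (simp add: rows comp_def)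
qed

lemma cvp_repr_reduction:
  "cvp_repr \<theta> p ((m + n) # n # concat (map rexp_code (matrix_entries (weight a b n m) @
       map (target_entry \<Phi>) [0..<m + n] @ [radius (weight a b n m) n m])))
     (reduction \<theta> p (weight a b) \<Phi>)"
proof -
  let ?es = "matrix_entries (weight a b n m)" and ?ts = "map (target_entry \<Phi>) [0..<m + n]"
  have "length ?es = (m + n) * n"
    by (simp add: matrix_entries_def length_concat comp_def sum_list_triv)
  moreover have "?es ! (i * n + j) = matrix_entry (weight a b n m) \<Phi> i j" if "i < m + n" "j < n" for i j
    using that nth_concat_blocks[of "[0..<m + n]" "\<lambda>i. map (matrix_entry (weight a b n m) \<Phi> i) [0..<n]" n i j]
    by (simp add: matrix_entries_def)
  then have "mat (m + n) n (\<lambda>(i, j). rval \<theta> p (matrix_entry (weight a b n m) \<Phi> i j)) =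
      mat (m + n) n (\<lambda>(i, j). rval \<theta> p (?es ! (i * n + j)))"
    by (intro eq_matI) auto
  moreover have "vec (m + n) (\<lambda>i. rval \<theta> p (target_entry \<Phi> i)) = vec (m + n) (\<lambda>i. rval \<theta> p (?ts ! i))"
    by (intro eq_vecI) auto
  ultimately show ?thesis
    unfolding reduction_def Let_def cvp_repr.simps n_def[symmetric] m_def[symmetric]
    by (intro exI[of _ "m + n"] exI[of _ n] exI[of _ ?es] exI[of _ ?ts]
        exI[of _ "radius (weight a b n m) n m"]) simp
qed

end

section \<open>The polynomial bound and the final assembly\<close>

lemma poly_time_reduction:
  "poly_time_computable {\<Phi>. two_sat_formula \<Phi>} cnf_code cnf_size (cvp_repr \<theta> p)
     (reduction \<theta> p (weight a b))"
proof -
  \<comment> \<open>\<open>X\<close> is the indeterminate. Both \<open>n\<close> and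
    \<open>m\<close> are at most the input size and the step bound is monotone in them, so
    \<open>q\<close> arises by putting \<open>X\<close> for both.\<close>
  define X :: "nat poly" where "X = [:0, 1:]"
  define q where "q = 3 + (X * (X * 8 + 4) + 2 + (X * (X * (30 * X + 22) + 4) + 2 +
    (X * 8 + X * 5 + 4 + (30 * X + 39))))"
  show ?thesis
    unfolding poly_time_computable_def
  proof (rule exI[of _ "reduction_com a b"], rule exI[of _ q], clarify)
    fix n cs
    assume "two_sat_formula (n, cs)"
    then interpret input "(n, cs)" "input_store (cnf_code (n, cs)) 0" "num_vars (n, cs)"
      "length (clauses (n, cs))"
      by unfold_locales simp_all
    let ?n = "num_vars (n, cs)" and ?m = "length (clauses (n, cs))"
    from runs_reduction_com[of "input_store (cnf_code (n, cs))" a b, OF refl] obtain k s where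
      ex: "exec (reduction_com a b) (input_store (cnf_code (n, cs))) k s
       ((?m + ?n) # ?n # concat (map rexp_code (matrix_entries (weight a b ?n ?m) @
       map (target_entry (n, cs)) [0..<?m + ?n] @ [radius (weight a b ?n ?m) ?n ?m])))"
      and k: "k \<le> 3 + (?m * (?n * 8 + 4) + 2 + (?n * (?n * (30 * ?m + 22) + 4) + 2 +
        (?m * 8 + ?n * 5 + 4 + (30 * ?m + 39))))"
      by (rule runsE)
    let ?x = "cnf_size (n, cs)"
    have le: "?m \<le> ?x" "?n \<le> ?x" by (simp_all add: cnf_size_def)
    have "k \<le> 3 + (?x * (?x * 8 + 4) + 2 + (?x * (?x * (30 * ?x + 22) + 4) + 2 +
        (?x * 8 + ?x * 5 + 4 + (30 * ?x + 39))))"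
      by (rule order_trans[OF k]) (intro add_mono mult_mono le order_refl; simp)
    also have "\<dots> = poly q ?x" by (simp add: q_def X_def)
    finally show "\<exists>k s out. exec (reduction_com a b) (input_store (cnf_code (n, cs))) k s out \<and>
        k \<le> poly q ?x \<and> cvp_repr \<theta> p out (reduction \<theta> p (weight a b) (n, cs))"
      using ex cvp_repr_reduction by blast
  qed
qed

theorem theorem5p1:
  fixes \<delta> \<epsilon> p \<gamma> :: real
  assumes "0 \<le> \<delta>" and "\<delta> < \<epsilon>" and "\<epsilon> \<le> 1" and "1 \<le> p"
    and "\<gamma> = ((\<delta> + (1 - \<delta>) * 3 powr p) / (\<epsilon> + (1 - \<epsilon>) * 3 powr p)) powr (1 / p)"
  shows "\<gamma> > 1 \<and>
    (\<exists>f. poly_time_computable {\<Phi>. two_sat_formula \<Phi>} cnf_code cnf_size (cvp_repr [\<delta>, \<epsilon>, p] p) f \<and>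
         (\<forall>\<Phi>. two_sat_formula \<Phi> \<longrightarrow> cvp_instance (num_vars \<Phi>) (f \<Phi>)) \<and>
         maps_promise f (gap_2sat \<delta> \<epsilon>) (gap_cvp \<gamma> p)) \<and>
    (\<epsilon> = 1 \<longrightarrow> \<gamma> = (\<delta> + (1 - \<delta>) * 3 powr p) powr (1 / p))"
proof -
  have three: "1 < (3::real) powr p" using assms(4) by simp
  have den: "0 < \<epsilon> + (1 - \<epsilon>) * 3 powr p" using assms by (intro add_pos_nonneg) auto
  \<comment> \<open>The product equals numerator minus denominator of the ratio in \<gamma>.\<close>
  have "0 < (\<epsilon> - \<delta>) * (3 powr p - 1)" using assms(2) three by simp
  then have "\<epsilon> + (1 - \<epsilon>) * 3 powr p < \<delta> + (1 - \<delta>) * 3 powr p" by (simp add: algebra_simps)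
  then have "1 < (\<delta> + (1 - \<delta>) * 3 powr p) / (\<epsilon> + (1 - \<epsilon>) * 3 powr p)" using den by simp
  then have gamma: "1 < \<gamma>" using assms(4) by (simp add: assms(5) gr_one_powr)
  \<comment> \<open>Both constants are fixed before any formula is given, so a single program with
    \<open>a\<close> and \<open>b\<close> written into it serves all inputs.\<close>
  obtain a b :: nat where ab: "\<forall>m :: nat. (0 :: nat) < m \<longrightarrow> (\<forall>k :: nat. 0 < (\<delta> * m - k)\<^sup>2 + a / b \<and>
      (k < \<delta> * m \<longrightarrow> a / b \<le> \<delta> * m - k))"
    using separation_constant[of \<delta>] by blast
  define f where "f = reduction [\<delta>, \<epsilon>, p] p (weight a b)"
  have bounds: "0 < rval [\<delta>, \<epsilon>, p] p (weight a b (num_vars \<Phi>) (length (clauses \<Phi>)))"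
      "k < \<delta> * length (clauses \<Phi>) \<Longrightarrow> num_vars \<Phi> * 3 powr p *
        rval [\<delta>, \<epsilon>, p] p (weight a b (num_vars \<Phi>) (length (clauses \<Phi>))) < \<delta> * length (clauses \<Phi>) - k"
    if "two_sat_formula \<Phi>" for \<Phi> and k :: nat
  proof -
    have m: "0 < length (clauses \<Phi>)" using that by (simp add: two_sat_formula_def)
    show "0 < rval [\<delta>, \<epsilon>, p] p (weight a b (num_vars \<Phi>) (length (clauses \<Phi>)))"
      and "k < \<delta> * length (clauses \<Phi>) \<Longrightarrow> num_vars \<Phi> * 3 powr p *
        rval [\<delta>, \<epsilon>, p] p (weight a b (num_vars \<Phi>) (length (clauses \<Phi>))) < \<delta> * length (clauses \<Phi>) - k"
      using weight_bounds[OF _ m, of \<delta> a b] ab m assms(2,3) by auto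
  qed
  have inst: "cvp_instance (num_vars \<Phi>) (f \<Phi>)" if "two_sat_formula \<Phi>" for \<Phi>
    unfolding f_def using assms that bounds by (intro cvp_instance_reduction) auto
  have "maps_promise f (gap_2sat \<delta> \<epsilon>) (gap_cvp \<gamma> p)"
    unfolding maps_promise_def
  proof (intro conjI ballI)
    fix \<Phi> assume "\<Phi> \<in> fst (gap_2sat \<delta> \<epsilon>)"
    then have \<Phi>: "two_sat_formula \<Phi>" "\<epsilon> \<le> sat_val \<Phi>" by (simp_all add: gap_2sat_def)
    obtain B t r where f: "f \<Phi> = (B, t, r)" by (cases "f \<Phi>")
    have "lp_dist p (lattice_of_basis B) t \<le> r"
      using reduction_yes[OF \<Phi>(1) assms(4) bounds(1)[OF \<Phi>(1)] \<Phi>(2) f[unfolded f_def]] .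
    then show "f \<Phi> \<in> fst (gap_cvp \<gamma> p)"
      using inst[OF \<Phi>(1)] by (auto simp: gap_cvp_def f simp del: cvp_instance.simps)
  next
    fix \<Phi> assume "\<Phi> \<in> snd (gap_2sat \<delta> \<epsilon>)"
    then have \<Phi>: "two_sat_formula \<Phi>" "sat_val \<Phi> < \<delta>" by (simp_all add: gap_2sat_def)
    obtain B t r where f: "f \<Phi> = (B, t, r)" by (cases "f \<Phi>")
    have "\<gamma> * r < lp_dist p (lattice_of_basis B) t"
      by (rule reduction_no[OF \<Phi>(1) assms(4) _ assms(3,1) _ assms(5) bounds(1)[OF \<Phi>(1)]
            bounds(2)[OF \<Phi>(1)] \<Phi>(2) f[unfolded f_def]]) (use assms in auto)
    then show "f \<Phi> \<in> snd (gap_cvp \<gamma> p)"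
      using inst[OF \<Phi>(1)] by (auto simp: gap_cvp_def f simp del: cvp_instance.simps)
  qed
  with gamma inst poly_time_reduction[of "[\<delta>, \<epsilon>, p]" p a b] show ?thesis
    unfolding f_def using assms(5) by auto
qed

end
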